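(* Let $p$ be a prime and let $G$ be a connected $p$-periodic graph, with $p$-periodicity realized by an automorphism $h$ of order $p$, and let $\overline G$ be the quotient graph of $G$ under $\langle h\rangle$. Then $N_G(u,x,y)\equiv \big(N_{\overline G}(u,x,y)\big)^p$ modulo the ideal of $\mathbb{Z}[u,x,y]$ generated by $p$ and $u^p-u$.
   Context: Graphs are finite 1-dimensional CW-complexes (loops and multiple edges are allowed). For an integer $p\ge 2$, a graph $G$ is called $p$-periodic if its automorphism group contains an element $h$ of order $p$ such that no edge of $G$ is mapped to itself by any nontrivial element of $\langle h\rangle\cong\mathbb{Z}_p$ (the induced action on edges is fixed-point free). The quotient graph $\overline G$ is obtained by identifying all vertices in each $\langle h\rangle$-orbit to a single vertex and all edges in each $\langle h\rangle$-orbit to a single edge. For a graph $G$ with edge set $E(G)$ and $q$ edges, the Negami polynomial is $N_G(u,x,y)=\sum_{Y\subseteq E(G)} u^{w(G-Y)}x^{q-|Y|}y^{|Y|}$, where $w(G-Y)$ denotes the number of connected components of the graph $G-Y$ obtained from $G$ by removing the edges in $Y$ (keeping all vertices). *)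

theory Defs
  imports
    "HOL-Algebra.Generated_Groups"
    "HOL-Algebra.Multiplicative_Group"
    "HOL-Combinatorics.Permutations"
    "HOL-Computational_Algebra.Primes"
    "HOL-Library.Poly_Mapping"
begin

section \<open>Finite graphs with loops and multiple edges\<close>

text \<open>
  A finite 1-dimensional CW-complex, given combinatorially: the 0-cells, the 1-cells, and for
  every 1-cell the set of its end points, which is a singleton exactly when the edge is a loop.
  Distinct edges may have the same end points.
\<close>

record ('v, 'e) graph =
  verts :: "'v set"
  edges :: "'e set"
  ends :: "'e \<Rightarrow> 'v set"

definition finite_graph :: "('v, 'e) graph \<Rightarrow> bool" where
  "finite_graph G \<longleftrightarrow> finite (verts G) \<and> finite (edges G) \<and>
     (\<forall>e\<in>edges G. \<exists>a\<in>verts G. \<exists>b\<in>verts G. ends G e = {a, b})"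

definition adjacency :: "('v, 'e) graph \<Rightarrow> ('v \<times> 'v) set" where
  "adjacency G = {(a, b). \<exists>e\<in>edges G. ends G e = {a, b}}"

definition connectedness :: "('v, 'e) graph \<Rightarrow> ('v \<times> 'v) set" where
  "connectedness G = (adjacency G)\<^sup>* \<inter> verts G \<times> verts G"

definition components :: "('v, 'e) graph \<Rightarrow> 'v set set" where
  "components G = verts G // connectedness G"

definition connected_graph :: "('v, 'e) graph \<Rightarrow> bool" where
  "connected_graph G \<longleftrightarrow> verts G \<noteq> {} \<and> (\<forall>a\<in>verts G. \<forall>b\<in>verts G. (a, b) \<in> connectedness G)"

definition delete_edges :: "('v, 'e) graph \<Rightarrow> 'e set \<Rightarrow> ('v, 'e) graph" where
  "delete_edges G Y = G\<lparr>edges := edges G - Y\<rparr>"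


section \<open>Automorphisms and periodicity\<close>

text \<open>
  An automorphism consists of a permutation of the vertices and a permutation of the edges that
  are compatible with incidence; with multiple edges or loops the former does not determine the
  latter.  Both components are the identity outside the graph (this is part of
  \<open>permutes\<close>), so equality of pairs is equality of automorphisms.
\<close>

definition automorphisms :: "('v, 'e) graph \<Rightarrow> (('v \<Rightarrow> 'v) \<times> ('e \<Rightarrow> 'e)) set" where
  "automorphisms G = {(f, g). f permutes verts G \<and> g permutes edges G \<and>
     (\<forall>e\<in>edges G. ends G (g e) = f ` ends G e)}"

definition aut_group :: "('v, 'e) graph \<Rightarrow> (('v \<Rightarrow> 'v) \<times> ('e \<Rightarrow> 'e)) monoid" where
  "aut_group G = \<lparr>carrier = automorphisms G,
     monoid.mult = (\<lambda>h k. (fst h \<circ> fst k, snd h \<circ> snd k)), one = (id, id)\<rparr>"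

abbreviation cyclic_subgroup ::
    "('v, 'e) graph \<Rightarrow> ('v \<Rightarrow> 'v) \<times> ('e \<Rightarrow> 'e) \<Rightarrow> (('v \<Rightarrow> 'v) \<times> ('e \<Rightarrow> 'e)) set" where
  "cyclic_subgroup G h \<equiv> generate (aut_group G) {h}"

definition realizes_periodicity ::
    "nat \<Rightarrow> ('v, 'e) graph \<Rightarrow> ('v \<Rightarrow> 'v) \<times> ('e \<Rightarrow> 'e) \<Rightarrow> bool" where
  "realizes_periodicity p G h \<longleftrightarrow> 2 \<le> p \<and> h \<in> carrier (aut_group G) \<and>
     group.ord (aut_group G) h = p \<and>
     (\<forall>k \<in> cyclic_subgroup G h - {\<one>\<^bsub>aut_group G\<^esub>}. \<forall>e\<in>edges G. snd k e \<noteq> e)"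

definition periodic_graph :: "nat \<Rightarrow> ('v, 'e) graph \<Rightarrow> bool" where
  "periodic_graph p G \<longleftrightarrow> (\<exists>h. realizes_periodicity p G h)"

definition vertex_orbit ::
    "('v, 'e) graph \<Rightarrow> ('v \<Rightarrow> 'v) \<times> ('e \<Rightarrow> 'e) \<Rightarrow> 'v \<Rightarrow> 'v set" where
  "vertex_orbit G h v = (\<lambda>k. fst k v) ` cyclic_subgroup G h"

definition edge_orbit ::
    "('v, 'e) graph \<Rightarrow> ('v \<Rightarrow> 'v) \<times> ('e \<Rightarrow> 'e) \<Rightarrow> 'e \<Rightarrow> 'e set" where
  "edge_orbit G h e = (\<lambda>k. snd k e) ` cyclic_subgroup G h"

text \<open>
  The vertices and edges of the quotient are the orbits.  The end points of an edge orbit are the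
  orbits of the end points of any of its members, so a non-loop edge whose two ends lie in one
  orbit becomes a loop (see \<open>ends_quotient_graph\<close> below).
\<close>

definition quotient_graph ::
    "('v, 'e) graph \<Rightarrow> ('v \<Rightarrow> 'v) \<times> ('e \<Rightarrow> 'e) \<Rightarrow> ('v set, 'e set) graph" where
  "quotient_graph G h = \<lparr>verts = vertex_orbit G h ` verts G,
     edges = edge_orbit G h ` edges G,
     ends = (\<lambda>O'. vertex_orbit G h ` (\<Union>e\<in>O'. ends G e))\<rparr>"

lemma group_aut_group: "group (aut_group G)"
proof (rule groupI)
  fix h k assume "h \<in> carrier (aut_group G)" "k \<in> carrier (aut_group G)"
  then show "h \<otimes>\<^bsub>aut_group G\<^esub> k \<in> carrier (aut_group G)"
    by (auto simp: aut_group_def automorphisms_def permutes_compose image_comp permutes_in_image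
        split: prod.splits)
next
  show "\<one>\<^bsub>aut_group G\<^esub> \<in> carrier (aut_group G)"
    by (auto simp: aut_group_def automorphisms_def permutes_id)
next
  fix h assume "h \<in> carrier (aut_group G)"
  then obtain f g where h: "h = (f, g)" and f: "f permutes verts G" and g: "g permutes edges G"
    and fg: "\<And>e. e \<in> edges G \<Longrightarrow> ends G (g e) = f ` ends G e"
    by (auto simp: aut_group_def automorphisms_def)
  have "ends G (inv_into UNIV g e) = inv_into UNIV f ` ends G e" if "e \<in> edges G" for e
  proof -
    have "ends G e = f ` ends G (inv_into UNIV g e)"
      using fg[of "inv_into UNIV g e"] that
      by (simp add: permutes_inverses[OF g] permutes_in_image[OF permutes_inv[OF g]])
    then show ?thesis by (simp add: image_comp comp_def permutes_inverses[OF f])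
  qed
  then have "(inv_into UNIV f, inv_into UNIV g) \<in> carrier (aut_group G)"
    using f g by (simp add: aut_group_def automorphisms_def permutes_inv)
  moreover have "(inv_into UNIV f, inv_into UNIV g) \<otimes>\<^bsub>aut_group G\<^esub> h = \<one>\<^bsub>aut_group G\<^esub>"
    using f g by (simp add: aut_group_def h permutes_inv_o)
  ultimately show "\<exists>k\<in>carrier (aut_group G). k \<otimes>\<^bsub>aut_group G\<^esub> h = \<one>\<^bsub>aut_group G\<^esub>"
    by blast
qed (auto simp: aut_group_def comp_assoc)

lemma cyclic_subgroup_subset:
  assumes "h \<in> carrier (aut_group G)"
  shows "cyclic_subgroup G h \<subseteq> automorphisms G"
  using group.generate_incl[OF group_aut_group, of "{h}" G] assms by (auto simp: aut_group_def)

lemma vertex_orbit_translate: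
  assumes h: "h \<in> carrier (aut_group G)" and k: "k \<in> cyclic_subgroup G h"
  shows "vertex_orbit G h (fst k v) = vertex_orbit G h v"
proof -
  interpret A: group "aut_group G" by (rule group_aut_group)
  have s: "subgroup (cyclic_subgroup G h) (aut_group G)"
    using h by (intro A.generate_is_subgroup) auto
  have mul: "fst (a \<otimes>\<^bsub>aut_group G\<^esub> b) w = fst a (fst b w)" for a b w
    by (simp add: aut_group_def)
  have "l \<in> (\<lambda>l. l \<otimes>\<^bsub>aut_group G\<^esub> k) ` cyclic_subgroup G h" if l: "l \<in> cyclic_subgroup G h" for l
  proof (rule image_eqI)
    have c: "l \<in> carrier (aut_group G)" "k \<in> carrier (aut_group G)"
      using subgroup.mem_carrier[OF s] l k by auto
    show "l = (l \<otimes>\<^bsub>aut_group G\<^esub> inv\<^bsub>aut_group G\<^esub> k) \<otimes>\<^bsub>aut_group G\<^esub> k"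
      using c by (simp add: A.m_assoc)
    show "l \<otimes>\<^bsub>aut_group G\<^esub> inv\<^bsub>aut_group G\<^esub> k \<in> cyclic_subgroup G h"
      using s l k by (simp add: subgroup.m_closed subgroup.m_inv_closed)
  qed
  then have "(\<lambda>l. l \<otimes>\<^bsub>aut_group G\<^esub> k) ` cyclic_subgroup G h = cyclic_subgroup G h"
    using subgroup.m_closed[OF s] k by blast
  then have "vertex_orbit G h v =
      (\<lambda>l. fst l v) ` (\<lambda>l. l \<otimes>\<^bsub>aut_group G\<^esub> k) ` cyclic_subgroup G h"
    by (simp only: vertex_orbit_def)
  also have "\<dots> = vertex_orbit G h (fst k v)"
    by (simp only: image_image vertex_orbit_def mul)
  finally show ?thesis ..
qed

lemma ends_quotient_graph:
  assumes h: "h \<in> carrier (aut_group G)" and e: "e \<in> edges G"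
  shows "ends (quotient_graph G h) (edge_orbit G h e) = vertex_orbit G h ` ends G e"
proof -
  have "vertex_orbit G h ` ends G (snd k e) = vertex_orbit G h ` ends G e"
    if k: "k \<in> cyclic_subgroup G h" for k
  proof -
    have "ends G (snd k e) = fst k ` ends G e"
      using cyclic_subgroup_subset[OF h] k e by (auto simp: automorphisms_def)
    then show ?thesis by (simp add: image_image vertex_orbit_translate[OF h k])
  qed
  moreover have "cyclic_subgroup G h \<noteq> {}" using generate.one by blast
  ultimately show ?thesis by (simp add: quotient_graph_def edge_orbit_def image_UN)
qed

lemma finite_graph_quotient_graph:
  assumes G: "finite_graph G" and h: "h \<in> carrier (aut_group G)"
  shows "finite_graph (quotient_graph G h)"
proof -
  have "\<exists>a\<in>verts (quotient_graph G h). \<exists>b\<in>verts (quotient_graph G h).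
      ends (quotient_graph G h) O' = {a, b}" if O': "O' \<in> edges (quotient_graph G h)" for O'
  proof -
    obtain e where e: "e \<in> edges G" "O' = edge_orbit G h e"
      using O' by (auto simp: quotient_graph_def)
    then obtain a b where ab: "a \<in> verts G" "b \<in> verts G" "ends G e = {a, b}"
      using G by (auto simp: finite_graph_def)
    have "ends (quotient_graph G h) O' = {vertex_orbit G h a, vertex_orbit G h b}"
      using ends_quotient_graph[OF h e(1)] e ab by simp
    then show ?thesis using ab by (auto simp: quotient_graph_def)
  qed
  then show ?thesis using G by (simp add: finite_graph_def quotient_graph_def)
qed


section \<open>The ring \<open>\<int>[u, x, y]\<close> and the Negami polynomial\<close>

text \<open>
  Polynomials are finitely supported integer-valued functions on exponent vectors, and multiplication
  is convolution; the exponent vectors here are indexed by exactly three variables.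
\<close>

datatype negami_var = Index_u | Index_x | Index_y

type_synonym negami_poly = "(negami_var \<Rightarrow>\<^sub>0 nat) \<Rightarrow>\<^sub>0 int"

definition indeterminate :: "negami_var \<Rightarrow> negami_poly" where
  "indeterminate i = Poly_Mapping.single (Poly_Mapping.single i 1) 1"

abbreviation var_u :: negami_poly where "var_u \<equiv> indeterminate Index_u"
abbreviation var_x :: negami_poly where "var_x \<equiv> indeterminate Index_x"
abbreviation var_y :: negami_poly where "var_y \<equiv> indeterminate Index_y"

definition negami :: "('v, 'e) graph \<Rightarrow> negami_poly" where
  "negami G = (\<Sum>Y\<in>Pow (edges G). var_u ^ card (components (delete_edges G Y)) *
     var_x ^ (card (edges G) - card Y) * var_y ^ card Y)"

text \<open>
  The ideal generated by a set is its span in the ring regarded as a module over itself.  The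
  qualified name avoids the carrier-based modules of HOL-Algebra.
\<close>

definition ideal_generated :: "'a::comm_ring_1 set \<Rightarrow> 'a set" where
  "ideal_generated S = Modules.module.span (*) S"

lemma module_times: "Modules.module ((*) :: 'a::comm_ring_1 \<Rightarrow> 'a \<Rightarrow> 'a)"
  by unfold_locales (auto simp: algebra_simps)

lemma mem_ideal_generated_pair:
  fixes a b c :: "'a::comm_ring_1"
  shows "c \<in> ideal_generated {a, b} \<longleftrightarrow> (\<exists>r s. c = r * a + s * b)"
proof -
  have "c \<in> Modules.module.span (*) {a, b} \<longleftrightarrow> (\<exists>r s. c - r * a = s * b)"
    unfolding Modules.module.span_insert[OF module_times]
      Modules.module.span_empty[OF module_times] by simp
  also have "\<dots> \<longleftrightarrow> (\<exists>r s. c = r * a + s * b)"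
    by (simp only: diff_eq_eq add.commute)
  finally show ?thesis unfolding ideal_generated_def .
qed

definition cong_modulo :: "'a::comm_ring_1 \<Rightarrow> 'a \<Rightarrow> 'a set \<Rightarrow> bool" where
  "cong_modulo a b I \<longleftrightarrow> a - b \<in> I"

end

theory Submission
  imports Defs "HOL-Number_Theory.Cong"
begin

text \<open>
  Orbits of a map of prime order \<open>p\<close> have \<open>1\<close> or \<open>p\<close> elements.  Applied to the action on edge sets
  \<open>Y\<close>, this kills modulo \<open>p\<close> all summands of the Negami polynomial except those with \<open>Y\<close> invariant.
  Since the action on edges is free, these \<open>Y\<close> are the preimages of the edge sets \<open>Z\<close> of the
  quotient, with \<open>|Y| = p |Z|\<close>.  The components of the quotient without \<open>Z\<close> are the orbits of the
  components of \<open>G - Y\<close>, so \<open>a\<close> fixed components and \<open>b\<close> free orbits give \<open>a + p b\<close> components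
  upstairs and \<open>a + b\<close> downstairs, and \<open>u^(a + p b)\<close>, \<open>u^(a + b)\<close> and \<open>u^(p (a + b))\<close> agree modulo
  \<open>u^p - u\<close>.  So the summand of \<open>Y\<close> is congruent to the \<open>p\<close>-th power of that of \<open>Z\<close>, and the
  \<open>p\<close>-th power map is additive modulo \<open>p\<close>.
\<close>

section \<open>Congruence modulo an ideal\<close>

lemma cong_modulo_refl: "cong_modulo a a (ideal_generated S)"
  by (simp add: cong_modulo_def ideal_generated_def Modules.module.span_zero[OF module_times])

lemma cong_modulo_sym:
  "cong_modulo a b (ideal_generated S) \<Longrightarrow> cong_modulo b a (ideal_generated S)"
  using Modules.module.span_neg[OF module_times, of "a - b" S]
  by (simp add: cong_modulo_def ideal_generated_def)

lemma cong_modulo_trans: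
  assumes "cong_modulo a b (ideal_generated S)" "cong_modulo b c (ideal_generated S)"
  shows "cong_modulo a c (ideal_generated S)"
  using Modules.module.span_add[OF module_times, of "a - b" S "b - c"] assms
  by (simp add: cong_modulo_def ideal_generated_def)

lemma cong_modulo_add:
  assumes "cong_modulo a b (ideal_generated S)" "cong_modulo c d (ideal_generated S)"
  shows "cong_modulo (a + c) (b + d) (ideal_generated S)"
  using Modules.module.span_add[OF module_times, of "a - b" S "c - d"] assms
  by (simp add: cong_modulo_def ideal_generated_def algebra_simps)

lemma cong_modulo_mult:
  fixes a b c d :: "'a::comm_ring_1"
  assumes "cong_modulo a b (ideal_generated S)" "cong_modulo c d (ideal_generated S)"
  shows "cong_modulo (a * c) (b * d) (ideal_generated S)"
proof -
  have "a * c - b * d = c * (a - b) + b * (c - d)"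
    by (simp add: algebra_simps)
  then show ?thesis
    using assms unfolding cong_modulo_def ideal_generated_def
    by (simp add: Modules.module.span_add[OF module_times] Modules.module.span_scale[OF module_times])
qed

lemma cong_modulo_power:
  fixes a b :: "'a::comm_ring_1"
  assumes "cong_modulo a b (ideal_generated S)"
  shows "cong_modulo (a ^ n) (b ^ n) (ideal_generated S)"
  by (induction n) (auto intro: cong_modulo_refl cong_modulo_mult assms)

lemma cong_modulo_sum:
  assumes "\<And>i. i \<in> A \<Longrightarrow> cong_modulo (a i) (b i) (ideal_generated S)"
  shows "cong_modulo (sum a A) (sum b A) (ideal_generated S)"
  using assms
  by (induction A rule: infinite_finite_induct) (auto intro: cong_modulo_refl cong_modulo_add)

lemma cong_modulo_prod:
  fixes a b :: "'i \<Rightarrow> 'a::comm_ring_1"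
  assumes "\<And>i. i \<in> A \<Longrightarrow> cong_modulo (a i) (b i) (ideal_generated S)"
  shows "cong_modulo (prod a A) (prod b A) (ideal_generated S)"
  using assms
  by (induction A rule: infinite_finite_induct) (auto intro: cong_modulo_refl cong_modulo_mult)

lemma cong_modulo_generator: "a - b \<in> S \<Longrightarrow> cong_modulo a b (ideal_generated S)"
  by (simp add: cong_modulo_def ideal_generated_def Modules.module.span_base[OF module_times])

lemma cong_modulo_multiple_0:
  assumes "a \<in> S"
  shows "cong_modulo (a * b) 0 (ideal_generated S)"
  using cong_modulo_mult[OF cong_modulo_generator[of a 0 S] cong_modulo_refl[of b S]] assms by simp

text \<open>All binomial coefficients strictly between the two ends are multiples of
  \<open>p\<close>, so only the end terms of the binomial expansion survive.\<close>

lemma cong_modulo_power_prime_add: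
  fixes a b :: "'a::comm_ring_1"
  assumes p: "prime p" and S: "of_nat p \<in> S"
  shows "cong_modulo ((a + b) ^ p) (a ^ p + b ^ p) (ideal_generated S)"
proof -
  have 0: "cong_modulo (of_nat (p choose k) * a ^ k * b ^ (p - k)) 0 (ideal_generated S)"
    if "k \<in> {1..<p}" for k
  proof -
    have "p dvd p choose k" using that p by (intro dvd_choose_prime) auto
    then obtain m where "p choose k = p * m" ..
    then show ?thesis using cong_modulo_multiple_0[OF S] by (simp add: mult.assoc)
  qed
  have "{..p} = insert 0 (insert p {1..<p})" using prime_gt_0_nat[OF p] by auto
  then have "(a + b) ^ p =
      (a ^ p + b ^ p) + (\<Sum>k\<in>{1..<p}. of_nat (p choose k) * a ^ k * b ^ (p - k))"
    using prime_gt_0_nat[OF p] by (simp add: binomial_ring)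
  moreover have "cong_modulo \<dots> (a ^ p + b ^ p + (\<Sum>k\<in>{1..<p}. 0)) (ideal_generated S)"
    by (intro cong_modulo_add cong_modulo_sum cong_modulo_refl 0)
  ultimately show ?thesis by simp
qed

lemma cong_modulo_power_prime_sum:
  fixes a :: "'i \<Rightarrow> 'a::comm_ring_1"
  assumes p: "prime p" and S: "of_nat p \<in> S"
  shows "cong_modulo (sum a A ^ p) (\<Sum>i\<in>A. a i ^ p) (ideal_generated S)"
proof (induction A rule: infinite_finite_induct)
  case (insert i A)
  then show ?case
    using cong_modulo_trans[OF cong_modulo_power_prime_add[OF assms]
        cong_modulo_add[OF cong_modulo_refl insert.IH]] by simp
\<comment> \<open>An empty or infinite index set makes both sums 0, and \<open>0 ^ p = 0\<close>
  because \<open>p\<close> is positive.\<close>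
qed (use prime_gt_0_nat[OF p] in \<open>auto intro: cong_modulo_refl simp: power_0_left\<close>)

section \<open>Maps of prime order\<close>

text \<open>Only forward iterates are collected. For a map of finite order they already form the
  whole orbit, so inverses never enter.\<close>

definition iterates :: "('a \<Rightarrow> 'a) \<Rightarrow> 'a \<Rightarrow> 'a set" where
  "iterates f x = range (\<lambda>k. (f ^^ k) x)"

lemma iterates_self: "x \<in> iterates f x"
  unfolding iterates_def by (rule range_eqI[where x = 0]) simp

lemma iterates_fixed: "f x = x \<Longrightarrow> iterates f x = {x}"
proof -
  assume "f x = x"
  then have "(f ^^ k) x = x" for k by (induction k) auto
  then show ?thesis by (simp add: iterates_def)
qed

lemma iterates_subset:
  assumes "f ` A \<subseteq> A" "x \<in> A"
  shows "iterates f x \<subseteq> A"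
proof -
  have "(f ^^ k) x \<in> A" for k using assms by (induction k) auto
  then show ?thesis by (auto simp: iterates_def)
qed

lemma funpow_image:
  fixes f :: "'a \<Rightarrow> 'a"
  shows "((`) f ^^ k) A = (f ^^ k) ` A"
  by (induction k) (simp_all add: image_image)

text \<open>The map may be the identity: a periodic automorphism can fix every vertex while moving
  every edge. Stating the equation on the whole type lets the induced map on sets inherit
  it.\<close>

locale prime_order_map =
  fixes f :: "'a \<Rightarrow> 'a" and p :: nat
  assumes prime_p: "prime p" and funpow_p: "f ^^ p = id"
begin

lemma funpow_mod: "(f ^^ (k mod p)) x = (f ^^ k) x"
  by (rule funpow_mod_eq) (simp add: funpow_p)

lemma inj_f: "inj f"
proof -
  obtain m where "p = Suc m" using prime_gt_0_nat[OF prime_p] gr0_implies_Suc by blast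
  then have "(f ^^ m) \<circ> f = id" using funpow_p funpow_Suc_right[of m f] by simp
  then show ?thesis using inj_on_imageI2 inj_on_id by metis
qed

text \<open>The total number of steps is a multiple of \<open>p\<close>, so further forward iterates
  take the place of an inverse.\<close>

lemma funpow_reverse: "(f ^^ ((p - 1) * k)) ((f ^^ k) x) = x"
proof -
  have "(p - 1) * k + k = p * k" using prime_gt_0_nat[OF prime_p] by (cases p) auto
  then have "(f ^^ ((p - 1) * k)) ((f ^^ k) x) = (f ^^ (p * k)) x"
    by (metis comp_apply funpow_add)
  then show ?thesis using funpow_mod[of "p * k" x] by simp
qed

lemma iterates_eq:
  assumes "y \<in> iterates f x"
  shows "iterates f y = iterates f x"
proof -
  obtain k where k: "y = (f ^^ k) x" using assms by (auto simp: iterates_def)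
  have "(f ^^ i) y \<in> iterates f x" for i
    by (auto simp: iterates_def k funpow_add[THEN fun_cong, simplified, symmetric])
  moreover have "(f ^^ i) x \<in> iterates f y" for i
  proof -
    have "(f ^^ i) x = (f ^^ (i + (p - 1) * k)) y"
      by (simp only: funpow_add comp_apply k funpow_reverse)
    then show ?thesis by (auto simp: iterates_def)
  qed
  ultimately show ?thesis by (auto simp: iterates_def)
qed

lemma iterates_eq_iff: "iterates f x = iterates f y \<longleftrightarrow> x \<in> iterates f y"
  using iterates_eq iterates_self by metis

text \<open>A repetition among the first \<open>p\<close> iterates would give a positive period
  below \<open>p\<close>. Such a period is prime to \<open>p\<close>, which forces \<open>x\<close>
  to be fixed.\<close>

lemma card_iterates:
  assumes "f x \<noteq> x"
  shows "card (iterates f x) = p"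
proof -
  have *: False if "i < j" "j < p" "(f ^^ i) x = (f ^^ j) x" for i j
  proof -
    define d where "d = j - i"
    have "(f ^^ i) ((f ^^ d) x) = (f ^^ i) x"
      using that by (simp add: d_def funpow_add[THEN fun_cong, simplified, symmetric])
    then have d: "(f ^^ d) x = x" using inj_f by (simp add: inj_fn inj_eq)
    have "coprime d p"
      using that prime_p by (simp add: d_def coprime_commute prime_imp_coprime nat_dvd_not_less)
    \<comment> \<open>\<open>m\<close> inverts the period \<open>d\<close> modulo \<open>p\<close>:
      iterating \<open>d * m\<close> times returns \<open>x\<close>, since \<open>d\<close> is a
      period, and also equals a single application of \<open>f\<close>.\<close>
    then obtain m where m: "[d * m = Suc 0] (mod p)"
      using cong_solve_coprime_nat by blast
    have "(f ^^ (d * m)) x = x" using funpow_mod_eq[OF d, of "d * m"] by simp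
    moreover have "(f ^^ (d * m)) x = (f ^^ 1) x"
      using funpow_mod[of "d * m" x] funpow_mod[of 1 x] m by (simp add: unique_euclidean_semiring_class.cong_def)
    ultimately show False using assms by simp
  qed
  then have "inj_on (\<lambda>k. (f ^^ k) x) {..<p}"
    by (intro linorder_inj_onI) auto
  moreover have "iterates f x = (\<lambda>k. (f ^^ k) x) ` {..<p}"
  proof -
    have "(f ^^ k) x \<in> (\<lambda>k. (f ^^ k) x) ` {..<p}" for k
      using funpow_mod[of k x, symmetric] prime_gt_0_nat[OF prime_p] by (intro image_eqI[where x = "k mod p"]) auto
    then show ?thesis by (auto simp: iterates_def)
  qed
  ultimately show ?thesis by (simp add: card_image)
qed

section \<open>Sums and powers over orbits\<close>

lemma fibre_iterates:
  assumes "f ` A \<subseteq> A" "x \<in> A"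
  shows "{y \<in> A. iterates f y = iterates f x} = iterates f x"
  using iterates_subset[OF assms] by (auto simp: iterates_eq_iff)

text \<open>The orbits partition an invariant set. With \<open>F\<close> constantly 1 this becomes a
  count of elements by orbit sizes.\<close>

lemma sum_over_iterates:
  assumes "finite A" "f ` A \<subseteq> A"
  shows "sum F A = (\<Sum>T\<in>iterates f ` A. sum F T)"
  unfolding sum.image_gen[OF assms(1), of F "iterates f"]
  using fibre_iterates[OF assms(2)] by (intro sum.cong) auto

text \<open>\<open>F\<close> is constant on each orbit, so an orbit of \<open>p\<close> points
  contributes a multiple of \<open>p\<close>.\<close>

lemma cong_modulo_sum_fixed_points:
  fixes F :: "'a \<Rightarrow> 'r::comm_ring_1"
  assumes S: "of_nat p \<in> S" and A: "finite A" "f ` A \<subseteq> A"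
    and F: "\<And>x. x \<in> A \<Longrightarrow> F (f x) = F x"
  shows "cong_modulo (sum F A) (sum F {x \<in> A. f x = x}) (ideal_generated S)"
proof -
  let ?B = "{x \<in> A. f x \<noteq> x}"
  \<comment> \<open>Injectivity keeps moved points moved: if \<open>f x\<close> were fixed, so would
    be \<open>x\<close>.\<close>
  have B: "finite ?B" "f ` ?B \<subseteq> ?B" using A inj_f by (auto dest: injD)
  have "cong_modulo (sum F T) 0 (ideal_generated S)" if T: "T \<in> iterates f ` ?B" for T
  proof -
    obtain x where x: "x \<in> ?B" "T = iterates f x" using T by auto
    have "(f ^^ k) x \<in> A \<and> F ((f ^^ k) x) = F x" for k
      using x A F by (induction k) auto
    then have "sum F T = (\<Sum>y\<in>T. F x)"
      using x by (intro sum.cong) (auto simp: iterates_def)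
    also have "\<dots> = of_nat p * F x"
      using x card_iterates by simp
    finally show ?thesis using cong_modulo_multiple_0[OF S] by simp
  qed
  then have "cong_modulo (sum F ?B) 0 (ideal_generated S)"
    using cong_modulo_sum[of "iterates f ` ?B" "sum F" "\<lambda>_. 0" S] sum_over_iterates[OF B, of F]
    by simp
  moreover have "sum F A = sum F {x \<in> A. f x = x} + sum F ?B"
    using A(1) by (subst sum.union_disjoint[symmetric]) (auto intro!: sum.cong)
  ultimately show ?thesis
    using cong_modulo_add[OF cong_modulo_refl] by fastforce
qed

text \<open>The power of \<open>u\<close> splits into one factor per orbit. An orbit has 1 or
  \<open>p\<close> points, and either way its factor is congruent to \<open>u\<close>.\<close>

lemma cong_modulo_power_card:
  fixes u :: "'r::comm_ring_1"
  assumes S: "u ^ p - u \<in> S" and A: "finite A" "f ` A \<subseteq> A"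
  shows "cong_modulo (u ^ card A) (u ^ card (iterates f ` A)) (ideal_generated S)"
proof -
  have "cong_modulo (u ^ card T) u (ideal_generated S)" if T: "T \<in> iterates f ` A" for T
  proof -
    obtain x where x: "T = iterates f x" using T by auto
    show ?thesis
      using cong_modulo_generator[OF S] x card_iterates[of x] iterates_fixed[of f x]
      by (cases "f x = x") (auto intro: cong_modulo_refl)
  qed
  then have "cong_modulo (\<Prod>T\<in>iterates f ` A. u ^ card T) (\<Prod>T\<in>iterates f ` A. u) (ideal_generated S)"
    by (rule cong_modulo_prod)
  moreover have "card A = (\<Sum>T\<in>iterates f ` A. card T)"
    using sum_over_iterates[OF A, of "\<lambda>_. 1 :: nat"] by simp
  ultimately show ?thesis by (simp add: power_sum)
qed

end


section \<open>Graphs with a periodic automorphism\<close>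

text \<open>Each image is in bijection with the classes of the common kernel on \<open>V\<close>.
  Components of different graphs are thus compared through vertices that represent them.\<close>

lemma card_image_cong_kernel:
  assumes "\<And>a b. a \<in> V \<Longrightarrow> b \<in> V \<Longrightarrow> \<phi> a = \<phi> b \<longleftrightarrow> \<psi> a = \<psi> b"
  shows "card (\<phi> ` V) = card (\<psi> ` V)"
proof (rule bij_betw_same_card)
  have *: "\<psi> (inv_into V \<phi> (\<phi> a)) = \<psi> a" if "a \<in> V" for a
    using assms[of "inv_into V \<phi> (\<phi> a)" a] that by (simp add: inv_into_into f_inv_into_f)
  show "bij_betw (\<lambda>x. \<psi> (inv_into V \<phi> x)) (\<phi> ` V) (\<psi> ` V)"
    unfolding bij_betw_def inj_on_def by (auto simp: * assms image_iff)
qed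

lemma rtrancl_map:
  assumes "\<And>x y. (x, y) \<in> r \<Longrightarrow> (f x, f y) \<in> s" "(a, b) \<in> r\<^sup>*"
  shows "(f a, f b) \<in> s\<^sup>*"
  using assms(2) by induction (auto intro: rtrancl_into_rtrancl assms(1))

lemma verts_delete_edges: "verts (delete_edges G Y) = verts G"
  by (simp add: delete_edges_def)

lemma adjacency_delete_edges:
  "(a, b) \<in> adjacency (delete_edges G Y) \<longleftrightarrow> (\<exists>e\<in>edges G - Y. ends G e = {a, b})"
  by (simp add: adjacency_def delete_edges_def)

lemma connectedness_iff:
  "(a, b) \<in> connectedness G \<longleftrightarrow> (a, b) \<in> (adjacency G)\<^sup>* \<and> a \<in> verts G \<and> b \<in> verts G"
  by (auto simp: connectedness_def)

lemma equiv_connectedness: "equiv (verts G) (connectedness G)"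
proof (rule equivI)
  have "sym (adjacency G)" by (auto simp: sym_def adjacency_def insert_commute)
  then have "sym ((adjacency G)\<^sup>*)" by (rule sym_rtrancl)
  then show "sym (connectedness G)" by (auto simp: sym_def connectedness_def)
  show "trans (connectedness G)" by (auto simp: trans_def connectedness_def)
qed (auto simp: connectedness_def refl_on_def)

lemma components_eq_image: "components G = (\<lambda>a. connectedness G `` {a}) ` verts G"
  by (auto simp: components_def quotient_def)

lemma component_eq_iff:
  assumes "a \<in> verts G" "b \<in> verts G"
  shows "connectedness G `` {a} = connectedness G `` {b} \<longleftrightarrow> (a, b) \<in> (adjacency G)\<^sup>*"
  using assms eq_equiv_class_iff[OF equiv_connectedness assms] by (simp add: connectedness_iff)

lemma nat_pow_aut_group:
  fixes k :: nat
  shows "h [^]\<^bsub>aut_group G\<^esub> k = (fst h ^^ k, snd h ^^ k)"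
proof (induction k)
  case 0
  then show ?case by (simp add: aut_group_def id_def)
next
  case (Suc k)
  \<comment> \<open>Group powers take the new factor on the right, whereas the defining equations of
    \<open>funpow\<close> compose on the left.\<close>
  then show ?case by (simp add: aut_group_def comp_def funpow_Suc_right del: funpow.simps)
qed

section \<open>The periodic automorphism as a map of prime order\<close>

locale prime_periodic_graph =
  fixes G :: "('v, 'e) graph" and h :: "('v \<Rightarrow> 'v) \<times> ('e \<Rightarrow> 'e)" and p :: nat
  assumes prime_p: "prime p" and finite_graph: "finite_graph G"
    and periodic: "realizes_periodicity p G h"
begin

abbreviation f where "f \<equiv> fst h"
abbreviation g where "g \<equiv> snd h"
abbreviation Q where "Q \<equiv> quotient_graph G h"

lemma h_carrier: "h \<in> carrier (aut_group G)"
  and ord_h: "group.ord (aut_group G) h = p"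
  using periodic by (auto simp: realizes_periodicity_def)

lemma f_permutes: "f permutes verts G"
  and g_permutes: "g permutes edges G"
  and ends_g: "e \<in> edges G \<Longrightarrow> ends G (g e) = f ` ends G e"
  using h_carrier by (auto simp: aut_group_def automorphisms_def)

text \<open>Since \<open>h\<close> has positive finite order, its nonnegative powers exhaust the
  subgroup. This turns the orbits in the quotient into \<open>iterates\<close>.\<close>

lemma cyclic_subgroup_eq: "cyclic_subgroup G h = range (\<lambda>k. (f ^^ k, g ^^ k))"
  using group.generate_pow_nat[OF group_aut_group h_carrier] ord_h prime_gt_0_nat[OF prime_p]
  by (auto simp: nat_pow_aut_group)

lemma vertex_orbit_eq: "vertex_orbit G h = iterates f"
  by (simp add: vertex_orbit_def cyclic_subgroup_eq iterates_def fun_eq_iff image_image)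

lemma edge_orbit_eq: "edge_orbit G h = iterates g"
  by (simp add: edge_orbit_def cyclic_subgroup_eq iterates_def fun_eq_iff image_image)

lemma funpow_p: "f ^^ p = id" "g ^^ p = id"
proof -
  have "(f ^^ p, g ^^ p) = \<one>\<^bsub>aut_group G\<^esub>"
    using group.pow_ord_eq_1[OF group_aut_group h_carrier] by (simp add: ord_h nat_pow_aut_group)
  also have "\<dots> = (id, id)" by (simp add: aut_group_def)
  finally show "f ^^ p = id" "g ^^ p = id" by simp_all
qed

sublocale F: prime_order_map f p
  by unfold_locales (rule prime_p funpow_p)+

sublocale E: prime_order_map g p
  by unfold_locales (rule prime_p funpow_p)+

text \<open>\<open>FS\<close> serves for components, which are vertex sets, and \<open>ES\<close>
  for the deleted edge sets \<open>Y\<close>.\<close>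

sublocale FS: prime_order_map "(`) f" p
  by unfold_locales (auto simp: prime_p funpow_image funpow_p fun_eq_iff)

sublocale ES: prime_order_map "(`) g" p
  by unfold_locales (auto simp: prime_p funpow_image funpow_p fun_eq_iff)

text \<open>\<open>h\<close> is nontrivial because its order exceeds 1. Freeness of the generator
  suffices later, as \<open>card_iterates\<close> makes every orbit of a moved edge full.\<close>

lemma g_free:
  assumes "e \<in> edges G"
  shows "g e \<noteq> e"
proof -
  have "h \<noteq> \<one>\<^bsub>aut_group G\<^esub>"
    using group.ord_eq_1[OF group_aut_group h_carrier] ord_h prime_gt_1_nat[OF prime_p] by auto
  moreover have "h \<in> cyclic_subgroup G h"
    by (simp add: generate.incl)
  ultimately show ?thesis
    using periodic assms by (auto simp: realizes_periodicity_def)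
qed

section \<open>Reachability under the automorphism\<close>

lemma finite_verts: "finite (verts G)" and finite_edges: "finite (edges G)"
  using finite_graph by (auto simp: finite_graph_def)

lemma funpow_f_in_verts: "a \<in> verts G \<Longrightarrow> (f ^^ k) a \<in> verts G"
  by (metis f_permutes permutes_in_funpow_image)

text \<open>\<open>Y\<close> need not be invariant, so it is moved along with the edges; injectivity
  of \<open>g\<close> keeps surviving edges outside its image.\<close>

lemma adjacency_shift:
  assumes "(a, b) \<in> adjacency (delete_edges G Y)"
  shows "(f a, f b) \<in> adjacency (delete_edges G (g ` Y))"
proof -
  obtain e where e: "e \<in> edges G" "e \<notin> Y" "ends G e = {a, b}"
    using assms by (auto simp: adjacency_delete_edges)
  have "g e \<in> edges G - g ` Y"
    using e E.inj_f permutes_in_image[OF g_permutes] by (auto simp: inj_eq)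
  moreover have "ends G (g e) = {f a, f b}" using e ends_g by simp
  ultimately show ?thesis by (auto simp: adjacency_delete_edges)
qed

lemma reachable_shift:
  assumes "(a, b) \<in> (adjacency (delete_edges G Y))\<^sup>*"
  shows "((f ^^ k) a, (f ^^ k) b) \<in> (adjacency (delete_edges G ((g ^^ k) ` Y)))\<^sup>*"
proof (induction k)
  case (Suc k)
  have "(f ((f ^^ k) a), f ((f ^^ k) b)) \<in> (adjacency (delete_edges G (g ` (g ^^ k) ` Y)))\<^sup>*"
    by (rule rtrancl_map[OF adjacency_shift Suc.IH])
  then show ?case by (simp add: image_image)
qed (use assms in simp)

lemma reachable_shift_iff:
  "(f a, f b) \<in> (adjacency (delete_edges G (g ` Y)))\<^sup>* \<longleftrightarrow> (a, b) \<in> (adjacency (delete_edges G Y))\<^sup>*"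
proof
  \<comment> \<open>One shift is undone by \<open>p - 1\<close> further shifts, which yields the
    converse from \<open>reachable_shift\<close>.\<close>
  have p: "f ^^ (p - 1) \<circ> f = id" "g ^^ (p - 1) \<circ> g = id"
    using funpow_p prime_gt_0_nat[OF prime_p] by (auto simp flip: funpow_Suc_right)
  assume "(f a, f b) \<in> (adjacency (delete_edges G (g ` Y)))\<^sup>*"
  from reachable_shift[OF this, of "p - 1"] show "(a, b) \<in> (adjacency (delete_edges G Y))\<^sup>*"
    using p[THEN fun_cong] by (simp add: image_image)
next
  assume "(a, b) \<in> (adjacency (delete_edges G Y))\<^sup>*"
  from reachable_shift[OF this, of 1]
  show "(f a, f b) \<in> (adjacency (delete_edges G (g ` Y)))\<^sup>*" by simp
qed

lemma card_components_shift:
  "card (components (delete_edges G (g ` Y))) = card (components (delete_edges G Y))"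
proof -
  have "components (delete_edges G (g ` Y)) =
      (\<lambda>a. connectedness (delete_edges G (g ` Y)) `` {f a}) ` verts G"
    unfolding components_eq_image verts_delete_edges
    \<comment> \<open>The vertices are reindexed along \<open>f\<close>, so that the components of
      both graphs are parametrised by the same \<open>a\<close>.\<close>
    by (subst (1) permutes_image[OF f_permutes, symmetric]) (simp only: image_image)
  moreover have "card \<dots> = card ((\<lambda>a. connectedness (delete_edges G Y) `` {a}) ` verts G)"
    by (rule card_image_cong_kernel)
      (simp add: component_eq_iff verts_delete_edges permutes_in_image[OF f_permutes] reachable_shift_iff)
  ultimately show ?thesis by (simp add: components_eq_image verts_delete_edges)
qed

section \<open>Edge sets of the quotient and invariant edge sets\<close>

lemma edges_Q: "edges Q = iterates g ` edges G" and verts_Q: "verts Q = iterates f ` verts G"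
  by (simp_all add: quotient_graph_def edge_orbit_eq vertex_orbit_eq)

lemma Union_orbits_subset:
  assumes "Z \<subseteq> edges Q"
  shows "\<Union>Z \<subseteq> edges G"
proof -
  have "iterates g e \<subseteq> edges G" if "e \<in> edges G" for e
    using that permutes_image[OF g_permutes] by (intro iterates_subset) auto
  then show ?thesis using assms by (fastforce simp: edges_Q)
qed

text \<open>Orbits are disjoint, so a member of \<open>Z\<close> that contains \<open>e\<close> can
  only be the orbit of \<open>e\<close>.\<close>

lemma iterates_mem_iff:
  assumes "Z \<subseteq> edges Q"
  shows "iterates g e \<in> Z \<longleftrightarrow> e \<in> \<Union>Z"
proof
  assume "e \<in> \<Union>Z"
  then obtain T d where "T \<in> Z" "T = iterates g d" "e \<in> T" using assms by (auto simp: edges_Q)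
  then show "iterates g e \<in> Z" using E.iterates_eq by auto
qed (use iterates_self in fast)

lemma edges_Q_minus:
  assumes "Z \<subseteq> edges Q"
  shows "edges Q - Z = iterates g ` (edges G - \<Union>Z)"
  using iterates_mem_iff[OF assms] unfolding edges_Q by blast

lemma image_Union_orbits:
  assumes "Z \<subseteq> edges Q"
  shows "g ` \<Union>Z = \<Union>Z"
proof
  show "\<Union>Z \<subseteq> g ` \<Union>Z"
  proof
    fix e assume e: "e \<in> \<Union>Z"
    \<comment> \<open>This iterate is the preimage of \<open>e\<close> under \<open>g\<close>, and
      it lies in the same orbit.\<close>
    have "(g ^^ (p - 1)) e \<in> iterates g e" by (auto simp: iterates_def)
    then have "(g ^^ (p - 1)) e \<in> \<Union>Z"
      using e iterates_mem_iff[OF assms] by auto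
    moreover have "g ((g ^^ (p - 1)) e) = e"
      using funpow_p(2)[THEN fun_cong, of e] prime_gt_0_nat[OF prime_p] by (cases p) auto
    ultimately show "e \<in> g ` \<Union>Z" by (metis imageI)
  qed
  show "g ` \<Union>Z \<subseteq> \<Union>Z"
  proof (rule image_subsetI)
    fix e assume e: "e \<in> \<Union>Z"
    have "g e \<in> iterates g e" unfolding iterates_def by (rule range_eqI[where x = 1]) simp
    then show "g e \<in> \<Union>Z" using e iterates_mem_iff[OF assms] by auto
  qed
qed

lemma iterates_image_Union:
  assumes "Z \<subseteq> edges Q"
  shows "iterates g ` \<Union>Z = Z"
proof
  show "iterates g ` \<Union>Z \<subseteq> Z"
    by (rule image_subsetI) (simp only: iterates_mem_iff[OF assms])
  show "Z \<subseteq> iterates g ` \<Union>Z"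
  proof
    fix T assume T: "T \<in> Z"
    then obtain e where "T = iterates g e" using assms by (auto simp: edges_Q)
    then show "T \<in> iterates g ` \<Union>Z" using T iterates_mem_iff[OF assms, of e] by blast
  qed
qed

text \<open>An invariant edge set is the union of the orbits of its elements. This reindexes the
  summands that survive modulo \<open>p\<close> by edge sets of the quotient.\<close>

lemma bij_betw_Union_orbits:
  "bij_betw Union (Pow (edges Q)) {Y \<in> Pow (edges G). g ` Y = Y}"
proof (rule bij_betw_byWitness[where f' = "(`) (iterates g)"])
  show "\<forall>Z\<in>Pow (edges Q). iterates g ` \<Union>Z = Z" by (simp add: iterates_image_Union)
  show "\<forall>Y\<in>{Y \<in> Pow (edges G). g ` Y = Y}. \<Union> (iterates g ` Y) = Y"
  proof
    fix Y assume "Y \<in> {Y \<in> Pow (edges G). g ` Y = Y}"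
    then show "\<Union> (iterates g ` Y) = Y" using iterates_self iterates_subset[of g Y] by fastforce
  qed
  show "Union ` Pow (edges Q) \<subseteq> {Y \<in> Pow (edges G). g ` Y = Y}"
    using Union_orbits_subset image_Union_orbits by blast
  show "(`) (iterates g) ` {Y \<in> Pow (edges G). g ` Y = Y} \<subseteq> Pow (edges Q)"
    by (auto simp: edges_Q)
qed

lemma card_Union_orbits:
  assumes "Z \<subseteq> edges Q"
  shows "card (\<Union>Z) = p * card Z"
proof -
  have "card (\<Union>Z) = (\<Sum>T\<in>iterates g ` \<Union>Z. card T)"
    using E.sum_over_iterates[of "\<Union>Z" "\<lambda>_. 1 :: nat"] image_Union_orbits[OF assms]
      finite_subset[OF Union_orbits_subset[OF assms] finite_edges] by simp
  also have "\<dots> = (\<Sum>T\<in>Z. card T)" by (simp only: iterates_image_Union[OF assms])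
  also have "\<dots> = (\<Sum>T\<in>Z. p)"
    using assms by (intro sum.cong) (auto simp: edges_Q E.card_iterates g_free)
  finally show ?thesis by simp
qed

text \<open>Together with \<open>card_Union_orbits\<close> this shows that \<open>G\<close> has
  \<open>p\<close> times as many edges as \<open>Q\<close>, which is needed for the exponent of
  \<open>var_x\<close>.\<close>

lemma Union_edges_Q: "\<Union>(edges Q) = edges G"
proof
  show "\<Union>(edges Q) \<subseteq> edges G" by (rule Union_orbits_subset) simp
  show "edges G \<subseteq> \<Union>(edges Q)" by (auto simp: edges_Q intro: iterates_self)
qed

section \<open>Components of the quotient\<close>

lemma adjacency_quotient:
  assumes Z: "Z \<subseteq> edges Q"
  shows "adjacency (delete_edges Q Z) =
    map_prod (iterates f) (iterates f) ` adjacency (delete_edges G (\<Union>Z))"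
proof -
  have ends: "ends Q (iterates g e) = iterates f ` ends G e" if "e \<in> edges G" for e
    using ends_quotient_graph[OF h_carrier that] by (simp add: edge_orbit_eq vertex_orbit_eq)
  have "(A, B) \<in> adjacency (delete_edges Q Z) \<longleftrightarrow>
      (\<exists>e\<in>edges G - \<Union>Z. iterates f ` ends G e = {A, B})" for A B
    by (auto simp: adjacency_delete_edges edges_Q_minus[OF Z] ends)
  moreover have "(\<exists>e\<in>edges G - \<Union>Z. iterates f ` ends G e = {A, B}) \<longleftrightarrow>
      (\<exists>a b. (a, b) \<in> adjacency (delete_edges G (\<Union>Z)) \<and> A = iterates f a \<and> B = iterates f b)" for A B
  proof
    assume "\<exists>e\<in>edges G - \<Union>Z. iterates f ` ends G e = {A, B}"
    then obtain e where e: "e \<in> edges G - \<Union>Z" "iterates f ` ends G e = {A, B}" by blast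
    obtain a b where ab: "ends G e = {a, b}"
      using e finite_graph by (auto simp: finite_graph_def)
    \<comment> \<open>Ends of an edge are unordered while \<open>adjacency\<close> holds ordered
      pairs, so \<open>A\<close> and \<open>B\<close> may match \<open>a\<close> and
      \<open>b\<close> in either order.\<close>
    have "A = iterates f a \<and> B = iterates f b \<or> A = iterates f b \<and> B = iterates f a"
      using e(2) unfolding ab by (auto simp: doubleton_eq_iff)
    moreover have "(a, b) \<in> adjacency (delete_edges G (\<Union>Z))" "(b, a) \<in> adjacency (delete_edges G (\<Union>Z))"
      using e ab by (auto simp: adjacency_delete_edges insert_commute)
    ultimately show "\<exists>a b. (a, b) \<in> adjacency (delete_edges G (\<Union>Z)) \<and> A = iterates f a \<and> B = iterates f b"
      by blast
  next
    assume "\<exists>a b. (a, b) \<in> adjacency (delete_edges G (\<Union>Z)) \<and> A = iterates f a \<and> B = iterates f b"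
    then show "\<exists>e\<in>edges G - \<Union>Z. iterates f ` ends G e = {A, B}"
      unfolding adjacency_delete_edges by (metis image_empty image_insert)
  qed
  moreover have "(A, B) \<in> map_prod (iterates f) (iterates f) ` R \<longleftrightarrow>
      (\<exists>a b. (a, b) \<in> R \<and> A = iterates f a \<and> B = iterates f b)" for A B R
    by force
  ultimately show ?thesis by (simp add: set_eq_iff)
qed

text \<open>A path downstairs has a lift starting at \<open>a\<close>, but its end is known only up
  to its orbit; \<open>k\<close> records which translate of \<open>b\<close> is reached.\<close>

lemma reachable_quotient_iff:
  assumes Z: "Z \<subseteq> edges Q"
  shows "(iterates f a, iterates f b) \<in> (adjacency (delete_edges Q Z))\<^sup>* \<longleftrightarrow>
    (\<exists>k. (a, (f ^^ k) b) \<in> (adjacency (delete_edges G (\<Union>Z)))\<^sup>*)"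
proof
  \<comment> \<open>Since the deleted set is invariant, translating a path does not leave the
    graph.\<close>
  have inv: "(g ^^ k) ` \<Union>Z = \<Union>Z" for k
    using image_Union_orbits[OF Z] by (induction k) (simp_all flip: image_image)
  \<comment> \<open>a path in the quotient lifts edge by edge, translating each edge to the end of the lift so far\<close>
  {
    fix B assume "(iterates f a, B) \<in> (adjacency (delete_edges Q Z))\<^sup>*"
    then have "\<exists>c. B = iterates f c \<and> (a, c) \<in> (adjacency (delete_edges G (\<Union>Z)))\<^sup>*"
    proof (induction rule: rtrancl_induct)
      case base
      then show ?case by blast
    next
      case (step B C)
      then obtain c where c: "B = iterates f c" "(a, c) \<in> (adjacency (delete_edges G (\<Union>Z)))\<^sup>*" by blast
      obtain b d where bd: "(b, d) \<in> adjacency (delete_edges G (\<Union>Z))" "B = iterates f b" "C = iterates f d"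
        using step.hyps(2) by (auto simp: adjacency_quotient[OF Z])
      obtain k where k: "c = (f ^^ k) b"
        using c(1) bd(2) iterates_self[of c f] by (auto simp: iterates_def)
      have "(c, (f ^^ k) d) \<in> (adjacency (delete_edges G (\<Union>Z)))\<^sup>*"
        using reachable_shift[OF r_into_rtrancl[OF bd(1)], of k] by (simp add: inv k)
      moreover have "iterates f ((f ^^ k) d) = C"
        unfolding bd(3) by (rule F.iterates_eq) (auto simp: iterates_def)
      ultimately show ?case using c(2) by (metis rtrancl_trans)
    qed
  }
  note lift = this
  assume "(iterates f a, iterates f b) \<in> (adjacency (delete_edges Q Z))\<^sup>*"
  from lift[OF this] obtain c where
    c: "iterates f b = iterates f c" "(a, c) \<in> (adjacency (delete_edges G (\<Union>Z)))\<^sup>*" by blast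
  have "c \<in> iterates f b" using c(1) iterates_self[of c f] by simp
  then show "\<exists>k. (a, (f ^^ k) b) \<in> (adjacency (delete_edges G (\<Union>Z)))\<^sup>*"
    using c(2) by (auto simp: iterates_def)
next
  assume "\<exists>k. (a, (f ^^ k) b) \<in> (adjacency (delete_edges G (\<Union>Z)))\<^sup>*"
  then obtain k where "(a, (f ^^ k) b) \<in> (adjacency (delete_edges G (\<Union>Z)))\<^sup>*" ..
  then have "(iterates f a, iterates f ((f ^^ k) b)) \<in> (adjacency (delete_edges Q Z))\<^sup>*"
    by (rule rtrancl_map[rotated]) (auto simp: adjacency_quotient[OF Z])
  moreover have "iterates f ((f ^^ k) b) = iterates f b"
    by (rule F.iterates_eq) (auto simp: iterates_def)
  ultimately show "(iterates f a, iterates f b) \<in> (adjacency (delete_edges Q Z))\<^sup>*" by simp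
qed

text \<open>For invariant \<open>Y\<close> the automorphism permutes the components of the remaining
  graph, following their representatives.\<close>

lemma image_component:
  assumes Y: "g ` Y = Y" and a: "a \<in> verts G"
  shows "f ` (connectedness (delete_edges G Y) `` {a}) = connectedness (delete_edges G Y) `` {f a}"
    (is "f ` (?R `` {a}) = _")
proof -
  have "(f a, f b) \<in> ?R \<longleftrightarrow> (a, b) \<in> ?R" for b
    using reachable_shift_iff[of a b Y]
    by (simp add: connectedness_iff verts_delete_edges Y permutes_in_image[OF f_permutes])
  moreover have "x \<in> f ` (?R `` {a})" if "(f a, x) \<in> ?R" for x
  proof -
    obtain c where "x = f c" using permutes_surj[OF f_permutes] by (meson surjD)
    then show ?thesis using that calculation by auto
  qed
  ultimately show ?thesis by auto
qed

text \<open>Both counts are sizes of images of \<open>verts G\<close>. Two vertices have the same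
  image exactly when the component of one contains a translate of the other, by
  \<open>reachable_quotient_iff\<close> downstairs and by the shifting of components
  upstairs.\<close>

lemma card_components_quotient:
  assumes Z: "Z \<subseteq> edges Q"
  shows "card (components (delete_edges Q Z)) =
    card (iterates ((`) f) ` components (delete_edges G (\<Union>Z)))"
    and "(`) f ` components (delete_edges G (\<Union>Z)) \<subseteq> components (delete_edges G (\<Union>Z))"
proof -
  let ?R = "connectedness (delete_edges G (\<Union>Z))"
  let ?S = "connectedness (delete_edges Q Z)"
  note inv = image_Union_orbits[OF Z]
  have shift: "((`) f ^^ k) (?R `` {a}) = ?R `` {(f ^^ k) a}" if "a \<in> verts G" for a k
    using that by (induction k) (simp_all add: image_component[OF inv] funpow_f_in_verts)
  have "components (delete_edges Q Z) = (\<lambda>a. ?S `` {iterates f a}) ` verts G"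
    by (simp add: components_eq_image verts_delete_edges verts_Q image_image)
  moreover have "card \<dots> = card ((\<lambda>a. iterates ((`) f) (?R `` {a})) ` verts G)"
  proof (rule card_image_cong_kernel)
    fix a b assume ab: "a \<in> verts G" "b \<in> verts G"
    have "iterates ((`) f) (?R `` {a}) = iterates ((`) f) (?R `` {b}) \<longleftrightarrow>
        (\<exists>k. ?R `` {a} = ?R `` {(f ^^ k) b})"
      unfolding FS.iterates_eq_iff by (auto simp: iterates_def shift[OF ab(2)])
    also have "\<dots> \<longleftrightarrow> (\<exists>k. (a, (f ^^ k) b) \<in> (adjacency (delete_edges G (\<Union>Z)))\<^sup>*)"
      using ab by (simp add: component_eq_iff verts_delete_edges funpow_f_in_verts)
    also have "\<dots> \<longleftrightarrow> ?S `` {iterates f a} = ?S `` {iterates f b}"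
      using ab by (simp add: component_eq_iff verts_delete_edges verts_Q reachable_quotient_iff[OF Z])
    finally show "?S `` {iterates f a} = ?S `` {iterates f b} \<longleftrightarrow>
        iterates ((`) f) (?R `` {a}) = iterates ((`) f) (?R `` {b})" by simp
  qed
  ultimately show "card (components (delete_edges Q Z)) =
    card (iterates ((`) f) ` components (delete_edges G (\<Union>Z)))"
    by (simp add: components_eq_image verts_delete_edges image_image)
  show "(`) f ` components (delete_edges G (\<Union>Z)) \<subseteq> components (delete_edges G (\<Union>Z))"
    by (auto simp: components_eq_image verts_delete_edges image_component[OF inv]
        permutes_in_image[OF f_permutes])
qed

section \<open>The congruence of the Negami polynomials\<close>

lemma negami_cong:
  "cong_modulo (negami G) (negami Q ^ p) (ideal_generated {of_nat p, var_u ^ p - var_u})"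
proof -
  let ?I = "ideal_generated {of_nat p, var_u ^ p - var_u :: negami_poly}"
  define t where "t Y = var_u ^ card (components (delete_edges G Y)) *
     var_x ^ (card (edges G) - card Y) * var_y ^ card Y" for Y
  define s where "s Z = var_u ^ card (components (delete_edges Q Z)) *
     var_x ^ (card (edges Q) - card Z) * var_y ^ card Z" for Z
  have "t (g ` Y) = t Y" for Y
    using E.inj_f by (simp add: t_def card_components_shift card_image inj_on_subset)
  then have "cong_modulo (negami G) (sum t {Y \<in> Pow (edges G). g ` Y = Y}) ?I"
    unfolding negami_def t_def[symmetric]
    using finite_edges permutes_image[OF g_permutes]
    by (intro ES.cong_modulo_sum_fixed_points) auto
  also have "sum t {Y \<in> Pow (edges G). g ` Y = Y} = (\<Sum>Z\<in>Pow (edges Q). t (\<Union>Z))"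
    by (rule sum.reindex_bij_betw[OF bij_betw_Union_orbits, symmetric])
  finally have *: "cong_modulo (negami G) (\<Sum>Z\<in>Pow (edges Q). t (\<Union>Z)) ?I" .
  moreover have "cong_modulo (\<Sum>Z\<in>Pow (edges Q). t (\<Union>Z)) (\<Sum>Z\<in>Pow (edges Q). s Z ^ p) ?I"
  proof (rule cong_modulo_sum)
    fix Z assume "Z \<in> Pow (edges Q)"
    then have Z: "Z \<subseteq> edges Q" by simp
    let ?w = "card (components (delete_edges Q Z))"
    have "finite (components (delete_edges G (\<Union>Z)))"
      by (simp add: components_eq_image verts_delete_edges finite_verts)
    then have "cong_modulo (var_u ^ card (components (delete_edges G (\<Union>Z)))) (var_u ^ ?w) ?I"
      unfolding card_components_quotient(1)[OF Z]
      by (intro FS.cong_modulo_power_card card_components_quotient(2)[OF Z]) auto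
    \<comment> \<open>The generator \<open>var_u ^ p - var_u\<close> is used a second time, now to
      raise the exponent to \<open>p * ?w\<close>, as the \<open>p\<close>-th power of
      \<open>s Z\<close> requires.\<close>
    moreover have "cong_modulo (var_u ^ ?w) ((var_u ^ p) ^ ?w) ?I"
      by (intro cong_modulo_sym[OF cong_modulo_power] cong_modulo_generator) simp
    ultimately have "cong_modulo (var_u ^ card (components (delete_edges G (\<Union>Z))))
        ((var_u ^ p) ^ ?w) ?I"
      by (rule cong_modulo_trans)
    moreover have "card (edges G) - card (\<Union>Z) = p * (card (edges Q) - card Z)"
      using card_Union_orbits[OF Z] card_Union_orbits[of "edges Q"] Union_edges_Q
      by (simp add: diff_mult_distrib2)
    then have "s Z ^ p = (var_u ^ p) ^ ?w *
        var_x ^ (card (edges G) - card (\<Union>Z)) * var_y ^ card (\<Union>Z)"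
      using card_Union_orbits[OF Z]
      by (simp add: s_def power_mult_distrib mult.commute flip: power_mult)
    ultimately show "cong_modulo (t (\<Union>Z)) (s Z ^ p) ?I"
      unfolding t_def by (auto intro: cong_modulo_mult cong_modulo_refl)
  qed
  moreover have "cong_modulo (\<Sum>Z\<in>Pow (edges Q). s Z ^ p) (negami Q ^ p) ?I"
    unfolding negami_def s_def[symmetric]
    by (intro cong_modulo_sym[OF cong_modulo_power_prime_sum] prime_p) simp
  ultimately show ?thesis using * by (blast intro: cong_modulo_trans)
qed

end

theorem theorem3p1:
  fixes p :: nat
    and G :: "('v, 'e) graph"
    and h :: "('v \<Rightarrow> 'v) \<times> ('e \<Rightarrow> 'e)"
  assumes "prime p"
    and "finite_graph G"
    and "connected_graph G"
    and "realizes_periodicity p G h"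
  shows "cong_modulo (negami G) (negami (quotient_graph G h) ^ p)
           (ideal_generated {of_nat p, var_u ^ p - var_u})"
proof -
  interpret prime_periodic_graph G h p
    using assms by unfold_locales
  show ?thesis by (rule negami_cong)
qed

end
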